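(* Let $F$ be a finite field with $q$ elements, $q$ odd. For $n\geq 2$, the set of (adjacency) eigenvalues of $\mathrm{Um}(F^n)$ is $\{\pm q^{n-1},\ \pm q^{(n-1)/2},\ \pm q^{n/2-1}\}$. For $n\geq 3$, the set of eigenvalues of $\mathrm{Um}_0(F^n)$ is $\{\pm (q^{n-1}-1)/(q-1),\ \pm q^{n/2-1}\}$.
   Context: Dot product on $F^n$: $a\cdot b=\sum_i a_ib_i$. For $n\geq 2$, $\mathrm{Um}(F^n)$ is the bipartite graph whose vertex set consists of two copies $\{a_\bullet\}$ and $\{b_\circ\}$ of the set of non-zero vectors of $F^n$, with $a_\bullet$ adjacent to $b_\circ$ iff $a\cdot b=1$. For $n\geq 3$, $\mathrm{Um}_0(F^n)$ is the bipartite graph on two copies of the projective space $(F^n\setminus\{0\})/F^*$, with $[a]_\bullet$ adjacent to $[b]_\circ$ iff $a\cdot b=0$. Eigenvalues are those of the adjacency matrix of the whole graph. *)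

theory Defs
  imports
    "Jordan_Normal_Form.Spectral_Radius"
    "Graph_Theory.Pair_Digraph"
    "HOL-Library.Cardinality"
begin

text \<open>
  Simple graphs are symmetric loop-free digraphs without parallel arcs (locale \<open>pair_graph\<close>),
  so each edge is present as two arcs. Vectors of \<open>F\<^sup>n\<close> are the elements of \<open>carrier_vec n\<close>, and
  \<open>\<bullet>\<close> is the bilinear product \<open>scalar_prod\<close>.
\<close>

definition adjacency_mat :: "'v pair_pre_digraph \<Rightarrow> 'v list \<Rightarrow> complex mat" where
  "adjacency_mat G vs =
     mat (length vs) (length vs) (\<lambda>(i, j). if (vs ! i, vs ! j) \<in> parcs G then 1 else 0)"

text \<open>
  The enumeration \<open>vs\<close> of the vertices is immaterial: see \<open>adjacency_eigenvalues_eq_spectrum\<close> below.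
  Eigenvalues are taken in the complex numbers.
\<close>

definition adjacency_eigenvalues :: "'v pair_pre_digraph \<Rightarrow> complex set" where
  "adjacency_eigenvalues G =
     (\<Union>vs \<in> {vs. distinct vs \<and> set vs = pverts G}. spectrum (adjacency_mat G vs))"

text \<open>
  The bipartite graph on two copies of \<open>A\<close>: \<open>Inl a\<close> is the black copy of \<open>a\<close> and
  \<open>Inr b\<close> the white copy of \<open>b\<close>.
\<close>

definition bipartite_graph :: "'v set \<Rightarrow> ('v \<times> 'v) set \<Rightarrow> ('v + 'v) pair_pre_digraph" where
  "bipartite_graph A R =
     \<lparr> pverts = A <+> A,
       parcs = {(Inl a, Inr b) | a b. a \<in> A \<and> b \<in> A \<and> (a, b) \<in> R} \<union>
               {(Inr b, Inl a) | a b. a \<in> A \<and> b \<in> A \<and> (a, b) \<in> R} \<rparr>"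

definition nonzero_vecs :: "nat \<Rightarrow> 'a::field vec set" where
  "nonzero_vecs n = carrier_vec n - {0\<^sub>v n}"

definition Um :: "nat \<Rightarrow> ('a::field vec + 'a vec) pair_pre_digraph" where
  "Um n = bipartite_graph (nonzero_vecs n) {(a, b). a \<bullet> b = 1}"

definition proportional :: "nat \<Rightarrow> ('a::field vec \<times> 'a vec) set" where
  "proportional n = {(a, b). a \<in> nonzero_vecs n \<and> b \<in> nonzero_vecs n \<and> (\<exists>c. c \<noteq> 0 \<and> b = c \<cdot>\<^sub>v a)}"

definition proj_space :: "nat \<Rightarrow> 'a::field vec set set" where
  "proj_space n = nonzero_vecs n // proportional n"

definition Um0 :: "nat \<Rightarrow> ('a::field vec set + 'a vec set) pair_pre_digraph" where
  "Um0 n = bipartite_graph (proj_space n)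
     {(proportional n `` {a}, proportional n `` {b}) | a b.
        a \<in> nonzero_vecs n \<and> b \<in> nonzero_vecs n \<and> a \<bullet> b = 0}"

lemma equiv_proportional: "equiv (nonzero_vecs n) (proportional n :: ('a::field vec \<times> 'a vec) set)"
proof (rule equivI)
  show "proportional n \<subseteq> nonzero_vecs n \<times> (nonzero_vecs n :: 'a vec set)"
    by (auto simp: proportional_def)
  show "refl_on (nonzero_vecs n) (proportional n :: ('a vec \<times> 'a vec) set)"
    by (auto simp: refl_on_def proportional_def intro!: exI[of _ 1])
  show "sym (proportional n :: ('a vec \<times> 'a vec) set)"
  proof (rule symI)
    fix a b :: "'a vec" assume "(a, b) \<in> proportional n"
    then obtain c where "a \<in> nonzero_vecs n" "b \<in> nonzero_vecs n" "c \<noteq> 0" "b = c \<cdot>\<^sub>v a"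
      by (auto simp: proportional_def)
    then show "(b, a) \<in> proportional n"
      by (auto simp: proportional_def smult_smult_assoc intro!: exI[of _ "inverse c"])
  qed
  show "trans (proportional n :: ('a vec \<times> 'a vec) set)"
  proof (rule transI)
    fix x y z :: "'a vec" assume "(x, y) \<in> proportional n" "(y, z) \<in> proportional n"
    then obtain c d where "x \<in> nonzero_vecs n" "z \<in> nonzero_vecs n"
      "c \<noteq> 0" "y = c \<cdot>\<^sub>v x" "d \<noteq> 0" "z = d \<cdot>\<^sub>v y"
      by (auto simp: proportional_def)
    then show "(x, z) \<in> proportional n"
      by (auto simp: proportional_def smult_smult_assoc intro!: exI[of _ "d * c"])
  qed
qed

lemma Um_adj_iff:
  fixes a b :: "'a::field vec"
  assumes "a \<in> nonzero_vecs n" "b \<in> nonzero_vecs n"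
  shows "(Inl a, Inr b) \<in> parcs (Um n) \<longleftrightarrow> a \<bullet> b = 1"
  using assms by (auto simp: Um_def bipartite_graph_def)

lemma Um0_adj_iff:
  fixes a b :: "'a::field vec"
  assumes a: "a \<in> nonzero_vecs n" and b: "b \<in> nonzero_vecs n"
  shows "(Inl (proportional n `` {a}), Inr (proportional n `` {b})) \<in> parcs (Um0 n)
           \<longleftrightarrow> a \<bullet> b = 0"
proof
  assume "a \<bullet> b = 0"
  then show "(Inl (proportional n `` {a}), Inr (proportional n `` {b})) \<in> parcs (Um0 n)"
    using assms by (auto simp: Um0_def bipartite_graph_def proj_space_def intro: quotientI)
next
  assume "(Inl (proportional n `` {a}), Inr (proportional n `` {b})) \<in> parcs (Um0 n)"
  then obtain a' b' where *: "a' \<in> nonzero_vecs n" "b' \<in> nonzero_vecs n" "a' \<bullet> b' = 0"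
    and eq: "proportional n `` {a} = proportional n `` {a'}"
      "proportional n `` {b} = proportional n `` {b'}"
    by (auto simp: Um0_def bipartite_graph_def)
  have "(a', a) \<in> proportional n" "(b', b) \<in> proportional n"
    using eq * a b eq_equiv_class_iff[OF equiv_proportional] by metis+
  then obtain c d where "a = c \<cdot>\<^sub>v a'" "b = d \<cdot>\<^sub>v b'"
    by (auto simp: proportional_def)
  moreover have "a' \<in> carrier_vec n" "b' \<in> carrier_vec n"
    using * by (auto simp: nonzero_vecs_def)
  ultimately show "a \<bullet> b = 0"
    using * by simp
qed

lemma pair_graph_bipartite_graph:
  assumes "finite A"
  shows "pair_graph (bipartite_graph A R)"
proof -
  have "finite (parcs (bipartite_graph A R))"
    by (rule finite_subset[of _ "(A <+> A) \<times> (A <+> A)"])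
       (use assms in \<open>auto simp: bipartite_graph_def\<close>)
  moreover have "finite (pverts (bipartite_graph A R))"
    using assms by (simp add: bipartite_graph_def)
  ultimately show ?thesis
    by unfold_locales (auto simp: bipartite_graph_def symmetric_def sym_def)
qed

lemma finite_nonzero_vecs: "finite (nonzero_vecs n :: 'a::{field,finite} vec set)"
proof -
  have "carrier_vec n \<subseteq> vec_of_list ` {xs :: 'a list. set xs \<subseteq> UNIV \<and> length xs = n}"
  proof
    fix v :: "'a vec" assume "v \<in> carrier_vec n"
    then show "v \<in> vec_of_list ` {xs. set xs \<subseteq> UNIV \<and> length xs = n}"
      by (intro image_eqI[of _ _ "list_of_vec v"]) (auto simp: vec_list)
  qed
  then have "finite (carrier_vec n :: 'a vec set)"
    by (rule finite_subset) (intro finite_imageI finite_lists_length_eq finite)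
  then show ?thesis by (simp add: nonzero_vecs_def)
qed

lemma pair_graph_Um: "pair_graph (Um n :: ('a::{field,finite} vec + 'a vec) pair_pre_digraph)"
  unfolding Um_def by (rule pair_graph_bipartite_graph[OF finite_nonzero_vecs])

lemma pair_graph_Um0: "pair_graph (Um0 n :: ('a::{field,finite} vec set + 'a vec set) pair_pre_digraph)"
  unfolding Um0_def proj_space_def
  by (intro pair_graph_bipartite_graph finite_quotient finite_nonzero_vecs)
     (auto simp: proportional_def)

lemma spectrum_adjacency_mat_iff:
  assumes "distinct vs"
  shows "k \<in> spectrum (adjacency_mat G vs) \<longleftrightarrow>
    (\<exists>f. (\<exists>v\<in>set vs. f v \<noteq> 0) \<and>
         (\<forall>v\<in>set vs. (\<Sum>w\<in>set vs. if (v, w) \<in> parcs G then f w else 0) = k * f v))"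
    (is "?L \<longleftrightarrow> ?R")
proof -
  let ?n = "length vs" and ?A = "adjacency_mat G vs"
  have row: "(?A *\<^sub>v x) $ i = (\<Sum>j<?n. if (vs ! i, vs ! j) \<in> parcs G then x $ j else 0)"
    if "i < ?n" "x \<in> carrier_vec ?n" for i x
    using that by (auto simp: adjacency_mat_def scalar_prod_def lessThan_atLeast0 intro!: sum.cong)
  have sum: "(\<Sum>w\<in>set vs. g w) = (\<Sum>j<?n. g (vs ! j))" for g :: "_ \<Rightarrow> complex"
    by (rule sum.reindex_bij_betw[symmetric], rule bij_betw_nth) (use assms in auto)
  have ev: "k \<in> spectrum ?A \<longleftrightarrow> (\<exists>x \<in> carrier_vec ?n. (\<exists>i<?n. x $ i \<noteq> 0) \<and>
    (\<forall>i<?n. (\<Sum>j<?n. if (vs ! i, vs ! j) \<in> parcs G then x $ j else 0) = k * x $ i))"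
    (is "_ \<longleftrightarrow> ?M")
  proof -
    have dim: "dim_row ?A = ?n" by (simp add: adjacency_mat_def)
    have "x \<noteq> 0\<^sub>v ?n \<longleftrightarrow> (\<exists>i<?n. x $ i \<noteq> 0)" if "x \<in> carrier_vec ?n" for x :: "complex vec"
      using that by (auto simp: vec_eq_iff)
    moreover have "?A *\<^sub>v x = k \<cdot>\<^sub>v x \<longleftrightarrow>
        (\<forall>i<?n. (\<Sum>j<?n. if (vs ! i, vs ! j) \<in> parcs G then x $ j else 0) = k * x $ i)"
      if "x \<in> carrier_vec ?n" for x
      using that row[OF _ that] dim by (auto simp: vec_eq_iff simp del: index_mult_mat_vec)
    ultimately show ?thesis
      unfolding spectrum_def eigenvalue_def eigenvector_def dim by blast
  qed
  show ?thesis
  proof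
    assume ?L
    then obtain x where x: "x \<in> carrier_vec ?n" "\<exists>i<?n. x $ i \<noteq> 0"
      "\<forall>i<?n. (\<Sum>j<?n. if (vs ! i, vs ! j) \<in> parcs G then x $ j else 0) = k * x $ i"
      unfolding ev by blast
    define f where "f v = x $ (THE i. i < ?n \<and> vs ! i = v)" for v
    have f: "f (vs ! i) = x $ i" if "i < ?n" for i
    proof -
      have "(THE j. j < ?n \<and> vs ! j = vs ! i) = i"
        by (rule the_equality) (use that assms in \<open>auto simp: nth_eq_iff_index_eq\<close>)
      then show ?thesis by (simp add: f_def)
    qed
    show ?R
    proof (intro exI[of _ f] conjI ballI)
      show "\<exists>v\<in>set vs. f v \<noteq> 0" using x(2) f by (metis nth_mem)
      fix v assume "v \<in> set vs"
      then obtain i where i: "i < ?n" "v = vs ! i" by (auto simp: in_set_conv_nth)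
      have "(\<Sum>w\<in>set vs. if (v, w) \<in> parcs G then f w else 0)
          = (\<Sum>j<?n. if (vs ! i, vs ! j) \<in> parcs G then x $ j else 0)"
        unfolding sum i(2) by (rule sum.cong) (auto simp: f)
      then show "(\<Sum>w\<in>set vs. if (v, w) \<in> parcs G then f w else 0) = k * f v"
        using x(3) i f by simp
    qed
  next
    assume ?R
    then obtain f where f: "\<exists>v\<in>set vs. f v \<noteq> 0"
      "\<forall>v\<in>set vs. (\<Sum>w\<in>set vs. if (v, w) \<in> parcs G then f w else 0) = k * f v"
      by blast
    let ?x = "vec ?n (\<lambda>i. f (vs ! i))"
    have "\<exists>i<?n. ?x $ i \<noteq> 0" using f(1) by (force simp: in_set_conv_nth)
    moreover have "(\<Sum>j<?n. if (vs ! i, vs ! j) \<in> parcs G then ?x $ j else 0) = k * ?x $ i"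
      if "i < ?n" for i
    proof -
      have "(\<Sum>j<?n. if (vs ! i, vs ! j) \<in> parcs G then ?x $ j else 0)
          = (\<Sum>w\<in>set vs. if (vs ! i, w) \<in> parcs G then f w else 0)"
        unfolding sum by (rule sum.cong) auto
      then show ?thesis using f(2) that by simp
    qed
    ultimately show ?L unfolding ev by (intro bexI[of _ ?x]) auto
  qed
qed

lemma adjacency_eigenvalues_eq_spectrum:
  assumes "distinct vs" "set vs = pverts G"
  shows "adjacency_eigenvalues G = spectrum (adjacency_mat G vs)"
proof -
  have "spectrum (adjacency_mat G us) = spectrum (adjacency_mat G vs)"
    if "distinct us" "set us = pverts G" for us
    using that assms by (auto simp: spectrum_adjacency_mat_iff)
  then show ?thesis
    using assms unfolding adjacency_eigenvalues_def by blast
qed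

end

theory Submission
  imports Defs "Berlekamp_Zassenhaus.Berlekamp_Type_Based"
begin

text \<open>
  Both graphs are bipartite with a symmetric biadjacency matrix \<open>N\<close>, so \<open>k\<close> is an eigenvalue iff
  \<open>k\<^sup>2\<close> is an eigenvalue of \<open>N\<^sup>2\<close>, whose entries count common neighbours. Let \<open>J\<close> be the all-ones
  matrix and \<open>P\<close> the 0/1 matrix of proportionality. Counting solutions of one or two linear
  equations gives \<open>N\<^sup>2 = q\<^sup>n\<^sup>-\<^sup>1 I + q\<^sup>n\<^sup>-\<^sup>2 (J - P)\<close> for \<open>Um\<close> and
  \<open>N\<^sup>2 = q\<^sup>n\<^sup>-\<^sup>2 I + (q\<^sup>n\<^sup>-\<^sup>2 - 1) / (q - 1) J\<close> for \<open>Um0\<close>. Such a matrix is diagonalised by the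
  constants, the functions of sum zero that are constant on the classes of \<open>P\<close>, and the
  functions whose sum over each class is zero.
\<close>

no_notation set_add (infixl \<open><+>\<index>\<close> 60)

section \<open>Spectra of kernels on finite sets\<close>

definition kernel_apply :: "'v set \<Rightarrow> ('v \<Rightarrow> 'v \<Rightarrow> 'k) \<Rightarrow> ('v \<Rightarrow> 'k) \<Rightarrow> 'v \<Rightarrow> 'k::field" where
  "kernel_apply A K f a = (\<Sum>b\<in>A. K a b * f b)"

definition kernel_comp :: "'v set \<Rightarrow> ('v \<Rightarrow> 'v \<Rightarrow> 'k) \<Rightarrow> ('v \<Rightarrow> 'v \<Rightarrow> 'k) \<Rightarrow> 'v \<Rightarrow> 'v \<Rightarrow> 'k::field" where
  "kernel_comp A K L a c = (\<Sum>b\<in>A. K a b * L b c)"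

definition eigenfunction :: "'v set \<Rightarrow> ('v \<Rightarrow> 'v \<Rightarrow> 'k) \<Rightarrow> ('v \<Rightarrow> 'k) \<Rightarrow> 'k::field \<Rightarrow> bool" where
  "eigenfunction A K f k \<longleftrightarrow> (\<exists>a\<in>A. f a \<noteq> 0) \<and> (\<forall>a\<in>A. kernel_apply A K f a = k * f a)"

definition kernel_spectrum :: "'v set \<Rightarrow> ('v \<Rightarrow> 'v \<Rightarrow> 'k) \<Rightarrow> 'k::field set" where
  "kernel_spectrum A K = {k. \<exists>f. eigenfunction A K f k}"

lemma kernel_apply_cong:
  assumes "\<And>b. b \<in> A \<Longrightarrow> K a b = L a b" and "\<And>b. b \<in> A \<Longrightarrow> f b = g b"
  shows "kernel_apply A K f a = kernel_apply A L g a"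
  unfolding kernel_apply_def by (rule sum.cong) (simp_all add: assms)

lemma kernel_apply_add:
  "kernel_apply A K (\<lambda>b. f b + g b) a = kernel_apply A K f a + kernel_apply A K g a"
  by (simp add: kernel_apply_def sum.distrib algebra_simps)

lemma kernel_apply_mult: "kernel_apply A K (\<lambda>b. x * f b) a = x * kernel_apply A K f a"
  by (simp add: kernel_apply_def sum_distrib_left mult.left_commute)

lemma kernel_apply_uminus: "kernel_apply A K (\<lambda>b. - f b) a = - kernel_apply A K f a"
  by (simp add: kernel_apply_def sum_negf)

lemma kernel_apply_kernel_comp:
  "kernel_apply A (kernel_comp A K L) f a = kernel_apply A K (kernel_apply A L f) a"
proof -
  have "kernel_apply A (kernel_comp A K L) f a = (\<Sum>c\<in>A. \<Sum>b\<in>A. K a b * (L b c * f c))"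
    by (simp add: kernel_apply_def kernel_comp_def sum_distrib_right mult.assoc)
  also have "\<dots> = (\<Sum>b\<in>A. \<Sum>c\<in>A. K a b * (L b c * f c))"
    by (rule sum.swap)
  finally show ?thesis
    by (simp add: kernel_apply_def sum_distrib_left)
qed

lemma kernel_spectrum_cong:
  assumes "\<And>a b. a \<in> A \<Longrightarrow> b \<in> A \<Longrightarrow> K a b = L a b"
  shows "kernel_spectrum A K = kernel_spectrum A L"
proof -
  have "kernel_apply A K f a = kernel_apply A L f a" if "a \<in> A" for f a
    by (rule kernel_apply_cong) (simp_all add: assms that)
  then show ?thesis
    by (simp add: kernel_spectrum_def eigenfunction_def)
qed

lemma power2_in_kernel_spectrum_comp:
  assumes "k \<in> kernel_spectrum A K"
  shows "k\<^sup>2 \<in> kernel_spectrum A (kernel_comp A K K)"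
proof -
  obtain f where f: "eigenfunction A K f k"
    using assms by (auto simp: kernel_spectrum_def)
  have "kernel_apply A (kernel_comp A K K) f a = k\<^sup>2 * f a" if "a \<in> A" for a
  proof -
    have "kernel_apply A (kernel_comp A K K) f a = kernel_apply A K (\<lambda>b. k * f b) a"
      unfolding kernel_apply_kernel_comp
      by (rule kernel_apply_cong) (use f in \<open>simp_all add: eigenfunction_def\<close>)
    also have "\<dots> = k\<^sup>2 * f a"
      using f that by (simp add: kernel_apply_mult eigenfunction_def power2_eq_square)
    finally show ?thesis .
  qed
  with f show ?thesis
    by (auto simp: kernel_spectrum_def eigenfunction_def)
qed

lemma power2_in_kernel_spectrum_comp_iff:
  "k\<^sup>2 \<in> kernel_spectrum A (kernel_comp A K K) \<longleftrightarrow>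
    k \<in> kernel_spectrum A K \<or> - k \<in> kernel_spectrum A K"
proof
  assume "k\<^sup>2 \<in> kernel_spectrum A (kernel_comp A K K)"
  then obtain f where nonzero: "\<exists>a\<in>A. f a \<noteq> 0"
    and square: "\<And>a. a \<in> A \<Longrightarrow> kernel_apply A K (kernel_apply A K f) a = k\<^sup>2 * f a"
    by (auto simp: kernel_spectrum_def eigenfunction_def kernel_apply_kernel_comp)
  \<comment> \<open>Since \<open>(K - k) (K + k) f = 0\<close>, either \<open>u = (K + k) f\<close> is an eigenfunction for \<open>k\<close>
    or \<open>f\<close> is one for \<open>-k\<close>.\<close>
  define u where "u a = kernel_apply A K f a + k * f a" for a
  have "kernel_apply A K u a = k * u a" if "a \<in> A" for a
    using square[OF that]
    by (simp add: u_def[abs_def] kernel_apply_add kernel_apply_mult power2_eq_square algebra_simps)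
  moreover have "kernel_apply A K f a = - k * f a" if "u a = 0" for a
    using that by (simp add: u_def add_eq_0_iff)
  ultimately have "eigenfunction A K u k \<or> eigenfunction A K f (- k)"
    using nonzero unfolding eigenfunction_def by blast
  then show "k \<in> kernel_spectrum A K \<or> - k \<in> kernel_spectrum A K"
    by (auto simp: kernel_spectrum_def)
next
  assume "k \<in> kernel_spectrum A K \<or> - k \<in> kernel_spectrum A K"
  then show "k\<^sup>2 \<in> kernel_spectrum A (kernel_comp A K K)"
    using power2_in_kernel_spectrum_comp[of k] power2_in_kernel_spectrum_comp[of "- k"] by auto
qed

definition eigenpair ::
  "'v set \<Rightarrow> ('v \<Rightarrow> 'v \<Rightarrow> 'k) \<Rightarrow> ('v \<Rightarrow> 'k) \<Rightarrow> ('v \<Rightarrow> 'k) \<Rightarrow> 'k::field \<Rightarrow> bool" where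
  "eigenpair A K f g k \<longleftrightarrow> (\<exists>a\<in>A. f a \<noteq> 0 \<or> g a \<noteq> 0) \<and>
    (\<forall>a\<in>A. kernel_apply A K g a = k * f a \<and> kernel_apply A K f a = k * g a)"

lemma eigenfunction_if_eigenpair:
  assumes "eigenpair A K f g k"
  shows "eigenfunction A K (\<lambda>a. f a + g a) k \<or> eigenfunction A K f (- k)"
proof (cases "\<exists>a\<in>A. f a + g a \<noteq> 0")
  case True
  then have "eigenfunction A K (\<lambda>a. f a + g a) k"
    using assms by (simp add: eigenpair_def eigenfunction_def kernel_apply_add algebra_simps)
  then show ?thesis ..
next
  case False
  then have "g a = - f a" if "a \<in> A" for a
    using that by (auto simp: add_eq_0_iff)
  then have "eigenfunction A K f (- k)"
    using assms by (auto simp: eigenpair_def eigenfunction_def)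
  then show ?thesis ..
qed

lemma eigenpair_if_eigenfunction:
  "eigenfunction A K f k \<Longrightarrow> eigenpair A K f f k"
  "eigenfunction A K f (- k) \<Longrightarrow> eigenpair A K f (\<lambda>a. - f a) k"
  by (auto simp: eigenpair_def eigenfunction_def kernel_apply_uminus)

lemma ex_eigenpair_iff:
  "(\<exists>f g. eigenpair A K f g k) \<longleftrightarrow> k \<in> kernel_spectrum A K \<or> - k \<in> kernel_spectrum A K"
  unfolding kernel_spectrum_def mem_Collect_eq
  using eigenfunction_if_eigenpair eigenpair_if_eigenfunction by metis

section \<open>Spectra of bipartite graphs\<close>

definition relation_kernel :: "('v \<times> 'v) set \<Rightarrow> 'v \<Rightarrow> 'v \<Rightarrow> 'k::field" where
  "relation_kernel R a b = of_bool ((a, b) \<in> R)"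

definition common_neighbours :: "'v set \<Rightarrow> ('v \<times> 'v) set \<Rightarrow> 'v \<Rightarrow> 'v \<Rightarrow> 'v set" where
  "common_neighbours A R a c = {b \<in> A. (a, b) \<in> R \<and> (b, c) \<in> R}"

lemma kernel_comp_relation_kernel:
  assumes "finite A"
  shows "kernel_comp A (relation_kernel R) (relation_kernel R) =
    (\<lambda>a c. of_nat (card (common_neighbours A R a c)))"
  using assms
  by (simp add: fun_eq_iff kernel_comp_def relation_kernel_def common_neighbours_def Int_def
      flip: of_bool_conj)

lemma sum_parcs_bipartite_graph:
  fixes h :: "'v + 'v \<Rightarrow> complex"
  assumes "finite A" and "sym_on A R" and "a \<in> A"
  shows "(\<Sum>w\<in>A <+> A. if (Inl a, w) \<in> parcs (bipartite_graph A R) then h w else 0) =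
      kernel_apply A (relation_kernel R) (h \<circ> Inr) a"
    and "(\<Sum>w\<in>A <+> A. if (Inr a, w) \<in> parcs (bipartite_graph A R) then h w else 0) =
      kernel_apply A (relation_kernel R) (h \<circ> Inl) a"
proof -
  have arcs: "(Inl a, Inr b) \<in> parcs (bipartite_graph A R) \<longleftrightarrow> (a, b) \<in> R"
    "(Inr a, Inl b) \<in> parcs (bipartite_graph A R) \<longleftrightarrow> (a, b) \<in> R"
    "(Inl a, Inl b) \<notin> parcs (bipartite_graph A R)"
    "(Inr a, Inr b) \<notin> parcs (bipartite_graph A R)" if "b \<in> A" for b
    using assms that by (auto simp: bipartite_graph_def dest: sym_onD)
  have kernel: "kernel_apply A (relation_kernel R) f a = (\<Sum>b\<in>A. if (a, b) \<in> R then f b else 0)"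
    for f :: "'v \<Rightarrow> complex"
    unfolding kernel_apply_def relation_kernel_def by (rule sum.cong) simp_all
  show "(\<Sum>w\<in>A <+> A. if (Inl a, w) \<in> parcs (bipartite_graph A R) then h w else 0) =
      kernel_apply A (relation_kernel R) (h \<circ> Inr) a"
    and "(\<Sum>w\<in>A <+> A. if (Inr a, w) \<in> parcs (bipartite_graph A R) then h w else 0) =
      kernel_apply A (relation_kernel R) (h \<circ> Inl) a"
    using \<open>finite A\<close> by (simp_all add: sum.Plus arcs kernel comp_def cong: sum.cong)
qed

lemma adjacency_eigenvalues_bipartite_graph_iff_eigenpair:
  assumes "finite A" and "sym_on A R"
  shows "k \<in> adjacency_eigenvalues (bipartite_graph A R) \<longleftrightarrow>
    (\<exists>f g. eigenpair A (relation_kernel R) f g k)"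
proof -
  let ?G = "bipartite_graph A R"
  obtain vs where vs: "distinct vs" "set vs = A <+> A"
    using finite_distinct_list[of "A <+> A"] \<open>finite A\<close> by auto
  have "k \<in> adjacency_eigenvalues ?G \<longleftrightarrow> (\<exists>h. (\<exists>v\<in>A <+> A. h v \<noteq> 0) \<and>
      (\<forall>v\<in>A <+> A. (\<Sum>w\<in>A <+> A. if (v, w) \<in> parcs ?G then h w else 0) = k * h v))"
    using adjacency_eigenvalues_eq_spectrum[OF vs(1), of ?G] spectrum_adjacency_mat_iff[OF vs(1)]
    by (simp add: vs(2) bipartite_graph_def)
  also have "\<dots> \<longleftrightarrow> (\<exists>h. eigenpair A (relation_kernel R) (h \<circ> Inl) (h \<circ> Inr) k)"
    using sum_parcs_bipartite_graph[OF assms]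
    by (intro arg_cong[where f = Ex]) (auto simp: fun_eq_iff eigenpair_def Plus_def ball_Un bex_Un)
  also have "\<dots> \<longleftrightarrow> (\<exists>f g. eigenpair A (relation_kernel R) f g k)"
    by (metis case_sum_o_inj)
  finally show ?thesis .
qed

lemma adjacency_eigenvalues_bipartite_graph:
  assumes "finite A" and "sym_on A R"
  shows "adjacency_eigenvalues (bipartite_graph A R) =
    {k. k\<^sup>2 \<in> kernel_spectrum A (\<lambda>a c. of_nat (card (common_neighbours A R a c)))}"
  by (simp add: set_eq_iff adjacency_eigenvalues_bipartite_graph_iff_eigenpair[OF assms]
      ex_eigenpair_iff power2_in_kernel_spectrum_comp_iff
      flip: kernel_comp_relation_kernel[OF \<open>finite A\<close>])

lemma complex_power2_eq_of_real_iff: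
  assumes "0 \<le> x"
  shows "k\<^sup>2 = complex_of_real x \<longleftrightarrow> k = complex_of_real (sqrt x) \<or> k = complex_of_real (- sqrt x)"
proof -
  have "complex_of_real x = (complex_of_real (sqrt x))\<^sup>2"
    using assms by (simp flip: of_real_power)
  then show ?thesis
    by (simp only: power2_eq_iff of_real_minus)
qed

lemma Collect_power2_in_of_real_image:
  assumes "\<And>x. x \<in> X \<Longrightarrow> 0 \<le> x"
  shows "{k. k\<^sup>2 \<in> complex_of_real ` X} = complex_of_real ` (\<Union>x\<in>X. {sqrt x, - sqrt x})"
proof -
  have "{k. k\<^sup>2 \<in> complex_of_real ` X} = (\<Union>x\<in>X. {k. k\<^sup>2 = complex_of_real x})"
    by auto
  also have "\<dots> = (\<Union>x\<in>X. complex_of_real ` {sqrt x, - sqrt x})"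
    using assms by (intro SUP_cong) (auto simp: complex_power2_eq_of_real_iff)
  finally show ?thesis
    by (simp add: image_UN)
qed

lemma sqrt_power_eq_powr: "0 < x \<Longrightarrow> sqrt (x ^ m) = x powr (real m / 2)"
  by (simp add: powr_half_sqrt[symmetric] powr_realpow[symmetric] powr_powr)

section \<open>Equivalence relations with classes of equal size\<close>

locale uniform_equiv =
  fixes A :: "'v set" and P :: "('v \<times> 'v) set" and m :: nat
  assumes finite: "finite A" and equiv: "equiv A P"
    and card_class: "a \<in> A \<Longrightarrow> card (P `` {a}) = m"
begin

definition class_sum :: "('v \<Rightarrow> 'k::field) \<Rightarrow> 'v \<Rightarrow> 'k" where
  "class_sum f a = sum f (P `` {a})"

definition class_kernel :: "'k \<Rightarrow> 'k \<Rightarrow> 'k \<Rightarrow> 'v \<Rightarrow> 'v \<Rightarrow> 'k::field" where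
  "class_kernel \<alpha> \<beta> \<gamma> a c = \<alpha> * of_bool (a = c) + \<beta> - \<gamma> * of_bool ((a, c) \<in> P)"

lemma class_eq: "P `` {a} = {c \<in> A. (a, c) \<in> P}"
  using equiv by (auto simp: equiv_def)

lemma class_eq_converse: "P `` {a} = {c \<in> A. (c, a) \<in> P}"
  using equiv by (auto simp: equiv_def sym_def)

lemma class_mem_iff: "(b, c) \<in> P \<Longrightarrow> (a, b) \<in> P \<longleftrightarrow> (a, c) \<in> P"
  using equiv unfolding equiv_def sym_def trans_def by blast

lemma finite_class: "finite (P `` {a})"
  unfolding class_eq using finite by simp

lemma kernel_apply_class_kernel:
  assumes "a \<in> A"
  shows "kernel_apply A (class_kernel \<alpha> \<beta> \<gamma>) f a = \<alpha> * f a + \<beta> * sum f A - \<gamma> * class_sum f a"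
proof -
  have "kernel_apply A (class_kernel \<alpha> \<beta> \<gamma>) f a =
      \<alpha> * (\<Sum>c\<in>A. of_bool (a = c) * f c) + \<beta> * sum f A - \<gamma> * (\<Sum>c\<in>A. of_bool ((a, c) \<in> P) * f c)"
    by (simp add: kernel_apply_def class_kernel_def sum.distrib sum_subtractf sum_distrib_left
        algebra_simps)
  also have "(\<Sum>c\<in>A. of_bool (a = c) * f c) = f a"
    using finite assms by (simp add: of_bool_def if_distrib[of "\<lambda>x. x * _"] cong: if_cong)
  also have "(\<Sum>c\<in>A. of_bool ((a, c) \<in> P) * f c) = class_sum f a"
    using finite by (simp add: class_sum_def class_eq sum.inter_filter of_bool_def
        if_distrib[of "\<lambda>x. x * _"] cong: if_cong)
  finally show ?thesis .
qed

lemma sum_class_sum: "sum (class_sum f) A = of_nat m * sum f A"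
proof -
  have "sum (class_sum f) A = (\<Sum>a\<in>A. \<Sum>c | c \<in> A \<and> (a, c) \<in> P. f c)"
    by (simp add: class_sum_def class_eq)
  also have "\<dots> = (\<Sum>c\<in>A. \<Sum>a | a \<in> A \<and> (a, c) \<in> P. f c)"
    by (rule sum.swap_restrict[OF finite finite])
  also have "\<dots> = (\<Sum>c\<in>A. of_nat m * f c)"
    using card_class by (simp flip: class_eq_converse)
  finally show ?thesis
    by (simp add: sum_distrib_left)
qed

lemma class_sum_invariant:
  assumes "a \<in> A" and "\<And>c. (a, c) \<in> P \<Longrightarrow> f c = f a"
  shows "class_sum f a = of_nat m * f a"
proof -
  have "class_sum f a = (\<Sum>c\<in>P `` {a}. f a)"
    unfolding class_sum_def by (rule sum.cong) (auto simp: assms(2))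
  then show ?thesis
    using card_class[OF assms(1)] by simp
qed

lemma class_sum_class_sum:
  assumes "a \<in> A"
  shows "class_sum (class_sum f) a = of_nat m * class_sum f a"
  by (rule class_sum_invariant[OF assms]) (simp add: class_sum_def equiv_class_eq[OF equiv])

lemma card_eq_mult_card_quotient:
  assumes "B \<subseteq> A" and "P `` B \<subseteq> B"
  shows "card B = m * card (B // P)"
proof -
  have subset: "B // P \<subseteq> A // P"
    using \<open>B \<subseteq> A\<close> by (auto simp: quotient_def)
  have "b \<in> P `` {b}" if "b \<in> B" for b
    using that \<open>B \<subseteq> A\<close> equiv_class_self[OF equiv] by blast
  then have Union: "\<Union> (B // P) = B"
    using \<open>P `` B \<subseteq> B\<close> by (auto simp: quotient_def)
  have "finite B"
    using \<open>B \<subseteq> A\<close> finite by (rule finite_subset)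
  have "m * card (B // P) = card (\<Union> (B // P))"
  proof (rule card_partition)
    show "finite (B // P)" "finite (\<Union> (B // P))"
      using \<open>finite B\<close> unfolding Union by (simp_all add: quotient_def)
    show "card C = m" if "C \<in> B // P" for C
      using that \<open>B \<subseteq> A\<close> card_class by (auto elim!: quotientE)
    show "C \<inter> D = {}" if "C \<in> B // P" "D \<in> B // P" "C \<noteq> D" for C D
      using that subset quotient_disj[OF equiv] by blast
  qed
  then show ?thesis
    by (simp add: Union)
qed

lemma class_sum_eq_self:
  assumes "m = 1" and "a \<in> A"
  shows "class_sum f a = f a"
proof -
  have "P `` {a} = {a}"
    using card_class[OF \<open>a \<in> A\<close>] equiv_class_self[OF equiv \<open>a \<in> A\<close>] \<open>m = 1\<close>
    by (metis card_1_singletonE singletonD)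
  then show ?thesis
    by (simp add: class_sum_def)
qed

lemma eigenfunction_class_kernelD:
  assumes "eigenfunction A (class_kernel \<alpha> \<beta> \<gamma>) f k" and "a \<in> A"
  shows "k * f a = \<alpha> * f a + \<beta> * sum f A - \<gamma> * class_sum f a"
  using assms kernel_apply_class_kernel[OF \<open>a \<in> A\<close>, of \<alpha> \<beta> \<gamma> f] by (simp add: eigenfunction_def)

lemma sum_eigenfunction_class_kernel:
  assumes "eigenfunction A (class_kernel \<alpha> \<beta> \<gamma>) f k"
  shows "k * sum f A = (\<alpha> + \<beta> * of_nat (card A) - \<gamma> * of_nat m) * sum f A"
proof -
  have "k * sum f A = (\<Sum>a\<in>A. \<alpha> * f a + \<beta> * sum f A - \<gamma> * class_sum f a)"
    using eigenfunction_class_kernelD[OF assms] by (simp add: sum_distrib_left)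
  also have "\<dots> = (\<alpha> + \<beta> * of_nat (card A) - \<gamma> * of_nat m) * sum f A"
    by (simp add: sum.distrib sum_subtractf sum_class_sum algebra_simps flip: sum_distrib_left)
  finally show ?thesis .
qed

lemma class_sum_eigenfunction_class_kernel:
  assumes "eigenfunction A (class_kernel \<alpha> \<beta> \<gamma>) f k" and "a \<in> A"
  shows "k * class_sum f a = (\<alpha> - \<gamma> * of_nat m) * class_sum f a + \<beta> * of_nat m * sum f A"
proof -
  have "k * class_sum f a = (\<Sum>c\<in>P `` {a}. \<alpha> * f c + \<beta> * sum f A - \<gamma> * class_sum f c)"
    using eigenfunction_class_kernelD[OF assms(1)]
    by (auto simp: class_sum_def sum_distrib_left class_eq intro!: sum.cong)
  also have "\<dots> = (\<alpha> - \<gamma> * of_nat m) * class_sum f a + \<beta> * of_nat m * sum f A"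
    using class_sum_class_sum[OF \<open>a \<in> A\<close>, of f] card_class[OF \<open>a \<in> A\<close>]
    by (simp add: class_sum_def sum.distrib sum_subtractf algebra_simps flip: sum_distrib_left)
  finally show ?thesis .
qed

lemma eigenfunction_class_kernel_cases:
  assumes "eigenfunction A (class_kernel \<alpha> \<beta> \<gamma>) f k"
  shows "k = \<alpha> + \<beta> * of_nat (card A) - \<gamma> * of_nat m \<or> k = \<alpha> - \<gamma> * of_nat m \<or> m \<noteq> 1 \<and> k = \<alpha>"
proof -
  obtain a where a: "a \<in> A" "f a \<noteq> 0"
    using assms by (auto simp: eigenfunction_def)
  consider (sum) "sum f A \<noteq> 0" | (class_sum) "sum f A = 0" "class_sum f a \<noteq> 0"
    | (zero_sums) "sum f A = 0" "class_sum f a = 0"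
    by blast
  then show ?thesis
  proof cases
    case sum
    then show ?thesis
      using sum_eigenfunction_class_kernel[OF assms] by simp
  next
    case class_sum
    then show ?thesis
      using class_sum_eigenfunction_class_kernel[OF assms a(1)] by simp
  next
    case zero_sums
    then have "m \<noteq> 1"
      using class_sum_eq_self[OF _ a(1), of f] a(2) by auto
    then show ?thesis
      using eigenfunction_class_kernelD[OF assms a(1)] a(2) zero_sums by simp
  qed
qed

lemma eigenfunction_class_kernel_const:
  assumes "A \<noteq> {}"
  shows "eigenfunction A (class_kernel \<alpha> \<beta> \<gamma>) (\<lambda>_. 1) (\<alpha> + \<beta> * of_nat (card A) - \<gamma> * of_nat m)"
  using assms by (auto simp: eigenfunction_def kernel_apply_class_kernel class_sum_invariant)

lemma eigenfunction_class_kernel_sum_0: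
  assumes "\<exists>a\<in>A. f a \<noteq> 0" and "sum f A = 0" and "\<And>a. a \<in> A \<Longrightarrow> class_sum f a = s * f a"
  shows "eigenfunction A (class_kernel \<alpha> \<beta> \<gamma>) f (\<alpha> - \<gamma> * s)"
  using assms by (simp add: eigenfunction_def kernel_apply_class_kernel algebra_simps)

lemma ex_class_invariant_sum_0:
  assumes "P \<noteq> A \<times> A"
  obtains f :: "'v \<Rightarrow> 'k::field"
  where "\<exists>a\<in>A. f a \<noteq> 0" and "sum f A = 0" and "\<And>a. a \<in> A \<Longrightarrow> class_sum f a = of_nat m * f a"
proof -
  obtain a b where ab: "a \<in> A" "b \<in> A" "(b, a) \<notin> P"
    using assms equiv by (auto simp: equiv_def)
  define f :: "'v \<Rightarrow> 'k" where "f c = of_bool ((a, c) \<in> P) - of_bool ((b, c) \<in> P)" for c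
  show ?thesis
  proof
    have "(a, a) \<in> P"
      using equiv_class_self[OF equiv ab(1)] by simp
    then have "f a = 1"
      using ab(3) by (simp add: f_def)
    then show "\<exists>a\<in>A. f a \<noteq> 0"
      using ab(1) by (intro bexI[of _ a]) simp_all
    have "(\<Sum>c\<in>A. of_bool ((d, c) \<in> P)) = (of_nat m :: 'k)" if "d \<in> A" for d
      using finite card_class[OF that] by (simp add: class_eq Int_def)
    then show "sum f A = 0"
      using ab by (simp add: f_def[abs_def] sum_subtractf)
    show "class_sum f c = of_nat m * f c" if "c \<in> A" for c
      using that by (rule class_sum_invariant) (simp add: f_def class_mem_iff)
  qed
qed

lemma ex_class_sum_0:
  assumes "A \<noteq> {}" and "m \<noteq> 1"
  obtains f :: "'v \<Rightarrow> 'k::field"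
  where "\<exists>a\<in>A. f a \<noteq> 0" and "sum f A = 0" and "\<And>a. class_sum f a = 0"
proof -
  obtain a where "a \<in> A"
    using \<open>A \<noteq> {}\<close> by blast
  then have "P `` {a} \<noteq> {a}"
    using card_class[of a] \<open>m \<noteq> 1\<close> by auto
  then obtain b where ab: "(a, b) \<in> P" "b \<noteq> a" "b \<in> A"
    using equiv_class_self[OF equiv \<open>a \<in> A\<close>] class_eq[of a] by auto
  define f :: "'v \<Rightarrow> 'k" where "f c = of_bool (c = a) - of_bool (c = b)" for c
  have sum_f: "sum f C = of_bool (a \<in> C) - of_bool (b \<in> C)" if "finite C" for C
    using that by (simp add: f_def[abs_def] sum_subtractf of_bool_def)
  show ?thesis
  proof
    have "f a = 1"
      using ab by (simp add: f_def)
    then show "\<exists>a\<in>A. f a \<noteq> 0"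
      using \<open>a \<in> A\<close> by (intro bexI[of _ a]) simp_all
    show "sum f A = 0"
      using sum_f[OF finite] \<open>a \<in> A\<close> ab by simp
    show "class_sum f c = 0" for c
      using sum_f[OF finite_class] class_mem_iff[OF ab(1)] by (simp add: class_sum_def)
  qed
qed

lemma kernel_spectrum_class_kernel:
  fixes \<alpha> \<beta> \<gamma> :: "'k::field"
  assumes "P \<noteq> A \<times> A"
  shows "kernel_spectrum A (class_kernel \<alpha> \<beta> \<gamma>) =
    {\<alpha> + \<beta> * of_nat (card A) - \<gamma> * of_nat m, \<alpha> - \<gamma> * of_nat m} \<union> (if m = 1 then {} else {\<alpha>})"
proof
  show "kernel_spectrum A (class_kernel \<alpha> \<beta> \<gamma>) \<subseteq>
      {\<alpha> + \<beta> * of_nat (card A) - \<gamma> * of_nat m, \<alpha> - \<gamma> * of_nat m} \<union> (if m = 1 then {} else {\<alpha>})"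
    using eigenfunction_class_kernel_cases by (fastforce simp: kernel_spectrum_def)
  have "A \<noteq> {}"
    using assms equiv by (auto simp: equiv_def)
  have "\<alpha> - \<gamma> * of_nat m \<in> kernel_spectrum A (class_kernel \<alpha> \<beta> \<gamma>)"
  proof -
    obtain f :: "'v \<Rightarrow> 'k" where "\<exists>a\<in>A. f a \<noteq> 0" "sum f A = 0"
      "\<And>a. a \<in> A \<Longrightarrow> class_sum f a = of_nat m * f a"
      using ex_class_invariant_sum_0[OF assms] by blast
    then have "eigenfunction A (class_kernel \<alpha> \<beta> \<gamma>) f (\<alpha> - \<gamma> * of_nat m)"
      by (rule eigenfunction_class_kernel_sum_0)
    then show ?thesis
      by (auto simp: kernel_spectrum_def)
  qed
  moreover have "\<alpha> \<in> kernel_spectrum A (class_kernel \<alpha> \<beta> \<gamma>)" if m: "m \<noteq> 1"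
  proof -
    obtain f :: "'v \<Rightarrow> 'k" where "\<exists>a\<in>A. f a \<noteq> 0" "sum f A = 0" "\<And>a. class_sum f a = 0"
      using ex_class_sum_0[OF \<open>A \<noteq> {}\<close> m] by blast
    then have "eigenfunction A (class_kernel \<alpha> \<beta> \<gamma>) f (\<alpha> - \<gamma> * 0)"
      by (intro eigenfunction_class_kernel_sum_0) simp_all
    then show ?thesis
      by (auto simp: kernel_spectrum_def)
  qed
  moreover have "\<alpha> + \<beta> * of_nat (card A) - \<gamma> * of_nat m \<in>
      kernel_spectrum A (class_kernel \<alpha> \<beta> \<gamma>)"
    using eigenfunction_class_kernel_const[OF \<open>A \<noteq> {}\<close>] unfolding kernel_spectrum_def by blast
  ultimately show "{\<alpha> + \<beta> * of_nat (card A) - \<gamma> * of_nat m, \<alpha> - \<gamma> * of_nat m} \<union>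
      (if m = 1 then {} else {\<alpha>}) \<subseteq> kernel_spectrum A (class_kernel \<alpha> \<beta> \<gamma>)"
    by simp
qed

end

lemma kernel_spectrum_diagonal_plus_const:
  fixes \<alpha> \<beta> :: "'k::field"
  assumes "finite A" and "a \<in> A" "b \<in> A" "a \<noteq> b"
  shows "kernel_spectrum A (\<lambda>a c. \<alpha> * of_bool (a = c) + \<beta>) = {\<alpha> + \<beta> * of_nat (card A), \<alpha>}"
proof -
  interpret uniform_equiv A "Id_on A" 1
  proof
    show "equiv A (Id_on A)"
      by (auto simp: equiv_def refl_on_def sym_def trans_def)
    show "card (Id_on A `` {a}) = 1" if "a \<in> A" for a
      using that by (auto simp: card_1_singleton_iff)
  qed fact
  have "Id_on A \<noteq> A \<times> A"
    using assms by auto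
  then show ?thesis
    using kernel_spectrum_class_kernel[of \<alpha> \<beta> 0] by (simp add: class_kernel_def[abs_def])
qed

section \<open>Counting solutions of linear equations over a finite field\<close>

lemma two_le_card_field: "2 \<le> CARD('a::{field,finite})"
  using card_mono[of "UNIV :: 'a set" "{0, 1}"] by simp

lemma nonzero_vecs_carrier: "a \<in> nonzero_vecs n \<Longrightarrow> a \<in> carrier_vec n"
  by (simp add: nonzero_vecs_def)

lemma nonzero_vecs_coordinate:
  assumes "a \<in> nonzero_vecs n"
  obtains i where "i < n" "a $ i \<noteq> 0"
  using assms by (auto simp: nonzero_vecs_def vec_eq_iff)

lemma smult_nonzero_vecs:
  assumes "a \<in> nonzero_vecs n" and "c \<noteq> 0"
  shows "c \<cdot>\<^sub>v a \<in> nonzero_vecs n"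
proof -
  obtain i where "i < n" "a $ i \<noteq> 0"
    using nonzero_vecs_coordinate[OF assms(1)] .
  then show ?thesis
    using assms by (auto simp: vec_eq_iff nonzero_vecs_def)
qed

lemma card_nonzero_vecs: "card (nonzero_vecs n :: 'a::{field,finite} vec set) = CARD('a) ^ n - 1"
  by (simp add: nonzero_vecs_def card_Diff_singleton card_carrier_vec)

lemma ex_scalar_prod_eq_1:
  assumes "a \<in> nonzero_vecs n"
  obtains d where "d \<in> carrier_vec n" and "a \<bullet> d = 1"
proof -
  obtain i where i: "i < n" "a $ i \<noteq> 0"
    using nonzero_vecs_coordinate[OF assms] .
  show ?thesis
    by (rule that[of "inverse (a $ i) \<cdot>\<^sub>v unit_vec n i"])
      (use i nonzero_vecs_carrier[OF assms] in auto)
qed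

lemma ex_scalar_prod_eq_0_1:
  assumes a: "a \<in> nonzero_vecs n" and b: "b \<in> nonzero_vecs n" and nonprop: "(a, b) \<notin> proportional n"
  obtains d where "d \<in> carrier_vec n" and "a \<bullet> d = 0" and "b \<bullet> d = 1"
proof -
  note carrier = nonzero_vecs_carrier[OF a] nonzero_vecs_carrier[OF b]
  obtain u where u: "u \<in> carrier_vec n" "a \<bullet> u = 1"
    using ex_scalar_prod_eq_1[OF a] .
  \<comment> \<open>The projections \<open>w i\<close> of the unit vectors along \<open>u\<close> span the hyperplane \<open>a \<bullet> x = 0\<close>. If \<open>b\<close>
    were orthogonal to all of them, it would be a multiple of \<open>a\<close>.\<close>
  define w where "w i = unit_vec n i - a $ i \<cdot>\<^sub>v u" for i
  have w: "w i \<in> carrier_vec n" "a \<bullet> w i = 0" "b \<bullet> w i = b $ i - a $ i * (b \<bullet> u)" if "i < n" for i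
    using that carrier u by (simp_all add: w_def scalar_prod_minus_distrib[of _ n])
  obtain i where i: "i < n" "b \<bullet> w i \<noteq> 0"
  proof (rule ccontr)
    assume "\<not> thesis"
    then have "b = (b \<bullet> u) \<cdot>\<^sub>v a"
      using that w(3) carrier by (auto simp: vec_eq_iff mult.commute)
    moreover from this have "b \<bullet> u \<noteq> 0"
      using b carrier by (auto simp: nonzero_vecs_def)
    ultimately show False
      using nonprop a b by (auto simp: proportional_def)
  qed
  show ?thesis
    by (rule that[of "inverse (b \<bullet> w i) \<cdot>\<^sub>v w i"]) (use w[OF i(1)] i(2) carrier in auto)
qed

lemma card_eq_mult_card_scalar_prod_fibre:
  fixes a d :: "'a::{field,finite} vec"
  assumes V: "V \<subseteq> carrier_vec n" and a: "a \<in> carrier_vec n" and d: "d \<in> carrier_vec n" "a \<bullet> d = 1"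
    and shift: "\<And>v c. v \<in> V \<Longrightarrow> v + c \<cdot>\<^sub>v d \<in> V"
  shows "card V = CARD('a) * card {v \<in> V. a \<bullet> v = s}"
proof -
  have fibre: "card {v \<in> V. a \<bullet> v = t} = card {v \<in> V. a \<bullet> v = s}" for t
  proof (rule bij_betw_same_card)
    have prod: "a \<bullet> (v + c \<cdot>\<^sub>v d) = a \<bullet> v + c" if "v \<in> V" for v c
      using that V a d by (auto simp: scalar_prod_add_distrib[of a n])
    have inverse: "v + c \<cdot>\<^sub>v d + c' \<cdot>\<^sub>v d = v" if "v \<in> V" "c + c' = 0" for v c c'
    proof -
      have v: "v \<in> carrier_vec n"
        using that V by auto
      then have "v + c \<cdot>\<^sub>v d + c' \<cdot>\<^sub>v d = v + (c + c') \<cdot>\<^sub>v d"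
        using d by (simp add: assoc_add_vec[of _ n] add_smult_distrib_vec)
      also have "(c + c') \<cdot>\<^sub>v d = 0\<^sub>v n"
        using d that(2) by auto
      finally show ?thesis
        using v by simp
    qed
    show "bij_betw (\<lambda>v. v + (s - t) \<cdot>\<^sub>v d) {v \<in> V. a \<bullet> v = t} {v \<in> V. a \<bullet> v = s}"
      by (rule bij_betwI[where g = "\<lambda>v. v + (t - s) \<cdot>\<^sub>v d"]) (auto simp: prod shift inverse)
  qed
  have "finite V"
    using V finite_carrier_vec by (rule finite_subset)
  then have "card V = (\<Sum>t\<in>UNIV. card {v \<in> V. a \<bullet> v = t})"
    by (subst card_UN_disjoint[symmetric]) (auto intro!: arg_cong[of _ _ card])
  also have "\<dots> = (\<Sum>t\<in>(UNIV :: 'a set). card {v \<in> V. a \<bullet> v = s})"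
    by (intro sum.cong refl fibre)
  finally show ?thesis
    by simp
qed

lemma card_affine_hyperplane:
  fixes a :: "'a::{field,finite} vec"
  assumes "a \<in> nonzero_vecs n"
  shows "card {b \<in> carrier_vec n. a \<bullet> b = s} = CARD('a) ^ (n - 1)"
proof -
  obtain d where "d \<in> carrier_vec n" "a \<bullet> d = 1"
    using ex_scalar_prod_eq_1[OF assms] .
  then have "CARD('a) ^ n = CARD('a) * card {b \<in> carrier_vec n. a \<bullet> b = s}"
    using card_eq_mult_card_scalar_prod_fibre[of "carrier_vec n" n a d s]
      nonzero_vecs_carrier[OF assms]
    by (simp add: card_carrier_vec)
  moreover have "0 < n"
    using nonzero_vecs_coordinate[OF assms] by fastforce
  ultimately show ?thesis
    by (simp add: power_eq_if)
qed

lemma card_affine_hyperplane_Int: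
  fixes a b :: "'a::{field,finite} vec"
  assumes "a \<in> nonzero_vecs n" and "b \<in> nonzero_vecs n" and "(a, b) \<notin> proportional n"
  shows "card {c \<in> carrier_vec n. a \<bullet> c = s \<and> b \<bullet> c = t} = CARD('a) ^ (n - 2)"
proof -
  let ?H = "{c \<in> carrier_vec n. a \<bullet> c = s}"
  note carrier = nonzero_vecs_carrier[OF assms(1)] nonzero_vecs_carrier[OF assms(2)]
  obtain d where d: "d \<in> carrier_vec n" "a \<bullet> d = 0" "b \<bullet> d = 1"
    using ex_scalar_prod_eq_0_1[OF assms] .
  have "card ?H = CARD('a) * card {c \<in> ?H. b \<bullet> c = t}"
    by (rule card_eq_mult_card_scalar_prod_fibre[of _ n b d])
      (use carrier d in \<open>auto simp: scalar_prod_add_distrib[of _ n]\<close>)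
  then have count: "CARD('a) ^ (n - 1) = CARD('a) * card {c \<in> carrier_vec n. a \<bullet> c = s \<and> b \<bullet> c = t}"
    by (simp add: card_affine_hyperplane[OF assms(1)])
  then have "n - 1 \<noteq> 0"
    using two_le_card_field[where 'a = 'a] by (intro notI) simp
  then have "CARD('a) ^ (n - 1) = CARD('a) * CARD('a) ^ (n - 2)"
    by (simp add: power_eq_if numeral_2_eq_2)
  then show ?thesis
    using count by simp
qed

section \<open>Proportional vectors\<close>

lemma proportional_refl: "a \<in> nonzero_vecs n \<Longrightarrow> (a, a) \<in> proportional n"
  using equiv_class_self[OF equiv_proportional] by simp

lemma proportional_Image:
  assumes "a \<in> nonzero_vecs n"
  shows "proportional n `` {a} = (\<lambda>c. c \<cdot>\<^sub>v a) ` (UNIV - {0})"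
  using assms smult_nonzero_vecs[OF assms] by (auto simp: proportional_def)

lemma proportional_Image_eq_iff:
  assumes "a \<in> nonzero_vecs n" and "b \<in> nonzero_vecs n"
  shows "proportional n `` {a} = proportional n `` {b} \<longleftrightarrow> (a, b) \<in> proportional n"
  by (rule eq_equiv_class_iff[OF equiv_proportional assms])

lemma card_proportional_Image:
  fixes a :: "'a::{field,finite} vec"
  assumes "a \<in> nonzero_vecs n"
  shows "card (proportional n `` {a}) = CARD('a) - 1"
proof -
  obtain i where i: "i < n" "a $ i \<noteq> 0"
    using nonzero_vecs_coordinate[OF assms] .
  have "inj (\<lambda>c. c \<cdot>\<^sub>v a)"
  proof (rule injI)
    fix x y assume "x \<cdot>\<^sub>v a = y \<cdot>\<^sub>v a"
    then have "(x \<cdot>\<^sub>v a) $ i = (y \<cdot>\<^sub>v a) $ i"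
      by simp
    then show "x = y"
      using i nonzero_vecs_carrier[OF assms] by simp
  qed
  then have "card ((\<lambda>c. c \<cdot>\<^sub>v a) ` (UNIV - {0})) = card (UNIV - {0} :: 'a set)"
    by (intro card_image) (auto intro: inj_on_subset)
  then show ?thesis
    by (simp add: proportional_Image[OF assms] card_Diff_singleton)
qed

interpretation proportional: uniform_equiv "nonzero_vecs n :: 'a::{field,finite} vec set"
  "proportional n" "CARD('a) - 1" for n
  by unfold_locales (simp_all add: finite_nonzero_vecs equiv_proportional card_proportional_Image)

lemma ex_not_proportional:
  assumes "2 \<le> n"
  obtains a b :: "'a::field vec"
  where "a \<in> nonzero_vecs n" and "b \<in> nonzero_vecs n" and "(a, b) \<notin> proportional n"
proof
  let ?a = "unit_vec n 0 :: 'a vec" and ?b = "unit_vec n 1 :: 'a vec"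
  show "?a \<in> nonzero_vecs n" "?b \<in> nonzero_vecs n"
    using assms by (auto simp: nonzero_vecs_def)
  show "(?a, ?b) \<notin> proportional n"
  proof
    assume "(?a, ?b) \<in> proportional n"
    then obtain c where "?b = c \<cdot>\<^sub>v ?a"
      by (auto simp: proportional_def)
    then have "?b $ 1 = (c \<cdot>\<^sub>v ?a) $ 1"
      by simp
    then show False
      using assms by simp
  qed
qed

lemma card_nonzero_vecs_eq_mult_card_proj_space:
  "card (nonzero_vecs n :: 'a vec set) =
    (CARD('a) - 1) * card (proj_space n :: 'a::{field,finite} vec set set)"
  unfolding proj_space_def
  by (rule proportional.card_eq_mult_card_quotient) (auto simp: proportional_def)

section \<open>The graph \<open>Um\<close>\<close>

lemma card_common_neighbours_Um:
  fixes a c :: "'a::{field,finite} vec"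
  assumes a: "a \<in> nonzero_vecs n" and c: "c \<in> nonzero_vecs n"
  shows "card (common_neighbours (nonzero_vecs n) {(a, b). a \<bullet> b = 1} a c) =
    (if a = c then CARD('a) ^ (n - 1)
     else if (a, c) \<in> proportional n then 0 else CARD('a) ^ (n - 2))"
proof -
  note carrier = nonzero_vecs_carrier[OF a] nonzero_vecs_carrier[OF c]
  have solutions: "common_neighbours (nonzero_vecs n) {(a, b). a \<bullet> b = 1} a c =
      {b \<in> carrier_vec n. a \<bullet> b = 1 \<and> c \<bullet> b = 1}"
    using carrier by (auto simp: common_neighbours_def nonzero_vecs_def comm_scalar_prod[of _ n])
  consider (equal) "a = c" | (multiple) x where "c = x \<cdot>\<^sub>v a" "a \<noteq> c" "(a, c) \<in> proportional n"
    | (nonprop) "a \<noteq> c" "(a, c) \<notin> proportional n"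
    by (auto simp: proportional_def)
  then show ?thesis
  proof cases
    case equal
    then show ?thesis
      unfolding solutions using card_affine_hyperplane[OF a, of 1] by simp
  next
    case multiple
    then have "x \<noteq> 1"
      by auto
    then have "{b \<in> carrier_vec n. a \<bullet> b = 1 \<and> c \<bullet> b = 1} = {}"
      using carrier multiple(1) by auto
    with multiple show ?thesis
      unfolding solutions by simp
  next
    case nonprop
    then show ?thesis
      unfolding solutions using card_affine_hyperplane_Int[OF a c, of 1 1] by simp
  qed
qed

lemma kernel_spectrum_common_neighbours_Um:
  assumes n: "2 \<le> n" and q: "q = CARD('a::{field,finite})" "q \<noteq> 2"
  shows "kernel_spectrum (nonzero_vecs n :: 'a vec set)
      (\<lambda>a c. of_nat (card (common_neighbours (nonzero_vecs n) {(a, b). a \<bullet> b = 1} a c))) =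
    complex_of_real ` {(real q ^ (n - 1))\<^sup>2, real q ^ (n - 1), real q ^ (n - 2)}"
    (is "kernel_spectrum ?A ?N = _")
proof -
  let ?\<alpha> = "of_nat q ^ (n - 1) :: complex" and ?\<beta> = "of_nat q ^ (n - 2) :: complex"
  have "?N a c = proportional.class_kernel n ?\<alpha> ?\<beta> ?\<beta> a c" if "a \<in> ?A" "c \<in> ?A" for a c
    using card_common_neighbours_Um[OF that] proportional_refl[OF that(1)]
    by (auto simp: q proportional.class_kernel_def)
  then have "kernel_spectrum ?A ?N = kernel_spectrum ?A (proportional.class_kernel n ?\<alpha> ?\<beta> ?\<beta>)"
    by (rule kernel_spectrum_cong)
  also have "\<dots> = {?\<alpha> + ?\<beta> * of_nat (q ^ n - 1) - ?\<beta> * of_nat (q - 1), ?\<alpha> - ?\<beta> * of_nat (q - 1), ?\<alpha>}"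
  proof -
    have "proportional n \<noteq> ?A \<times> ?A"
      using ex_not_proportional[OF n, where 'a = 'a] by auto
    moreover have "CARD('a) - 1 \<noteq> 1"
      using q by simp
    ultimately show ?thesis
      by (simp add: proportional.kernel_spectrum_class_kernel card_nonzero_vecs q insert_commute)
  qed
  also have "\<dots> = complex_of_real ` {(real q ^ (n - 1))\<^sup>2, real q ^ (n - 2), real q ^ (n - 1)}"
  proof -
    obtain m where m: "n = m + 2"
      using n that[of "n - 2"] by simp
    have "1 \<le> q"
      using two_le_card_field[where 'a = 'a] q by simp
    then show ?thesis
      by (simp add: m algebra_simps power2_eq_square power_add)
  qed
  finally show ?thesis
    by (simp only: insert_commute)
qed

theorem adjacency_eigenvalues_Um:
  assumes n: "2 \<le> n" and q: "q = CARD('a::{field,finite})" "q \<noteq> 2"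
  shows "adjacency_eigenvalues (Um n :: ('a vec + 'a vec) pair_pre_digraph) =
    complex_of_real ` {real q ^ (n - 1), - (real q ^ (n - 1)),
      real q powr ((real n - 1) / 2), - (real q powr ((real n - 1) / 2)),
      real q powr (real n / 2 - 1), - (real q powr (real n / 2 - 1))}"
proof -
  have sym: "sym_on (nonzero_vecs n) {(a, b :: 'a vec). a \<bullet> b = 1}"
    by (auto simp: sym_on_def nonzero_vecs_def comm_scalar_prod[of _ n])
  have "0 < q"
    using q by simp
  have "adjacency_eigenvalues (Um n :: ('a vec + 'a vec) pair_pre_digraph) =
      {k. k\<^sup>2 \<in> complex_of_real ` {(real q ^ (n - 1))\<^sup>2, real q ^ (n - 1), real q ^ (n - 2)}}"
    by (simp only: Um_def adjacency_eigenvalues_bipartite_graph[OF finite_nonzero_vecs sym]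
        kernel_spectrum_common_neighbours_Um[OF n q])
  also have "\<dots> = complex_of_real ` (\<Union>x\<in>{(real q ^ (n - 1))\<^sup>2, real q ^ (n - 1), real q ^ (n - 2)}.
      {sqrt x, - sqrt x})"
    by (rule Collect_power2_in_of_real_image) auto
  finally show ?thesis
    using n \<open>0 < q\<close> by (simp add: sqrt_power_eq_powr diff_divide_distrib insert_commute)
qed

section \<open>The graph \<open>Um0\<close>\<close>

definition proj_orthogonal :: "nat \<Rightarrow> ('a::field vec set \<times> 'a vec set) set" where
  "proj_orthogonal n = {(proportional n `` {a}, proportional n `` {b}) | a b.
     a \<in> nonzero_vecs n \<and> b \<in> nonzero_vecs n \<and> a \<bullet> b = 0}"

lemma Um0_eq_bipartite_graph: "Um0 n = bipartite_graph (proj_space n) (proj_orthogonal n)"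
  by (simp add: Um0_def proj_orthogonal_def)

lemma proj_space_eq_image: "proj_space n = (\<lambda>a. proportional n `` {a}) ` nonzero_vecs n"
  by (auto simp: proj_space_def quotient_def)

lemma finite_proj_space: "finite (proj_space n :: 'a::{field,finite} vec set set)"
  by (simp add: proj_space_eq_image finite_nonzero_vecs)

lemma proj_orthogonal_iff:
  assumes "a \<in> nonzero_vecs n" and "b \<in> nonzero_vecs n"
  shows "(proportional n `` {a}, proportional n `` {b}) \<in> proj_orthogonal n \<longleftrightarrow> a \<bullet> b = 0"
proof -
  have "proportional n `` {a} \<in> proj_space n" "proportional n `` {b} \<in> proj_space n"
    using assms by (simp_all add: proj_space_def quotientI)
  then show ?thesis
    using Um0_adj_iff[OF assms] by (simp add: Um0_eq_bipartite_graph bipartite_graph_def)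
qed

lemma sym_on_proj_orthogonal: "sym_on (proj_space n) (proj_orthogonal n)"
  by (auto simp: sym_on_def proj_space_eq_image proj_orthogonal_iff nonzero_vecs_def
      comm_scalar_prod[of _ n])

lemma common_neighbours_proj_orthogonal:
  assumes "a \<in> nonzero_vecs n" and "c \<in> nonzero_vecs n"
  shows "common_neighbours (proj_space n) (proj_orthogonal n)
      (proportional n `` {a}) (proportional n `` {c}) =
    {b \<in> nonzero_vecs n. a \<bullet> b = 0 \<and> c \<bullet> b = 0} // proportional n"
proof -
  have "b \<bullet> c = c \<bullet> b" if "b \<in> nonzero_vecs n" for b
    using that assms(2) by (intro comm_scalar_prod nonzero_vecs_carrier)
  then show ?thesis
    using assms
    by (auto simp: common_neighbours_def proj_space_eq_image quotient_def proj_orthogonal_iff)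
qed

lemma card_common_neighbours_proj_orthogonal:
  fixes a c :: "'a::{field,finite} vec"
  assumes a: "a \<in> nonzero_vecs n" and c: "c \<in> nonzero_vecs n"
  shows "(CARD('a) - 1) * card (common_neighbours (proj_space n) (proj_orthogonal n)
      (proportional n `` {a}) (proportional n `` {c})) =
    (if (a, c) \<in> proportional n then CARD('a) ^ (n - 1) else CARD('a) ^ (n - 2)) - 1"
proof -
  let ?B = "{b \<in> nonzero_vecs n. a \<bullet> b = 0 \<and> c \<bullet> b = 0}"
    and ?S = "{b \<in> carrier_vec n. a \<bullet> b = 0 \<and> c \<bullet> b = 0}"
  note carrier = nonzero_vecs_carrier[OF a] nonzero_vecs_carrier[OF c]
  have "(CARD('a) - 1) * card (?B // proportional n) = card ?B"
    by (rule proportional.card_eq_mult_card_quotient[symmetric])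
      (use carrier in \<open>auto simp: proportional_def nonzero_vecs_def\<close>)
  also have "card ?B = card (?S - {0\<^sub>v n})"
    by (rule arg_cong[where f = card]) (auto simp: nonzero_vecs_def)
  also have "\<dots> = card ?S - 1"
    using carrier by (intro card_Diff_singleton) auto
  also have "card ?S = (if (a, c) \<in> proportional n then CARD('a) ^ (n - 1) else CARD('a) ^ (n - 2))"
  proof (cases "(a, c) \<in> proportional n")
    case True
    then have "?S = {b \<in> carrier_vec n. a \<bullet> b = 0}"
      using carrier by (auto simp: proportional_def)
    then show ?thesis
      using True card_affine_hyperplane[OF a, of 0] by simp
  next
    case False
    then show ?thesis
      using card_affine_hyperplane_Int[OF a c, of 0 0] by simp
  qed
  finally show ?thesis
    by (simp add: common_neighbours_proj_orthogonal[OF assms])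
qed

lemma of_nat_eq_divide_if_mult_eq:
  assumes "(q - 1) * k = x - 1" and "2 \<le> q" and "1 \<le> x"
  shows "of_nat k = (of_nat x - 1) / (of_nat q - 1 :: 'k::field_char_0)"
proof -
  have "of_nat ((q - 1) * k) = (of_nat (x - 1) :: 'k)"
    by (rule arg_cong[OF assms(1)])
  then have "(of_nat q - 1) * of_nat k = (of_nat x - 1 :: 'k)"
    using assms(2,3) by simp
  moreover have "of_nat q - 1 \<noteq> (0 :: 'k)"
    using \<open>2 \<le> q\<close> by (auto simp: of_nat_eq_1_iff)
  ultimately show ?thesis
    by (simp add: field_simps)
qed

lemma of_nat_card_proj_space:
  assumes "q = CARD('a::{field,finite})"
  shows "of_nat (card (proj_space n :: 'a vec set set)) =
    (of_nat q ^ n - 1) / (of_nat q - 1 :: 'k::field_char_0)"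
proof -
  have "(q - 1) * card (proj_space n :: 'a vec set set) = q ^ n - 1"
    using card_nonzero_vecs_eq_mult_card_proj_space[of n, where 'a = 'a]
    by (simp add: card_nonzero_vecs assms)
  then have "of_nat (card (proj_space n :: 'a vec set set)) =
      (of_nat (q ^ n) - 1) / (of_nat q - 1 :: 'k)"
    using two_le_card_field[where 'a = 'a] assms by (intro of_nat_eq_divide_if_mult_eq) simp_all
  then show ?thesis
    by simp
qed

lemma of_nat_card_common_neighbours_proj_orthogonal:
  fixes X Y :: "'a::{field,finite} vec set"
  assumes "2 \<le> n" and q: "q = CARD('a)" and "X \<in> proj_space n" "Y \<in> proj_space n"
  shows "of_nat (card (common_neighbours (proj_space n) (proj_orthogonal n) X Y)) =
    of_nat q ^ (n - 2) * of_bool (X = Y) +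
      (of_nat q ^ (n - 2) - 1) / (of_nat q - 1 :: 'k::field_char_0)"
proof -
  have "2 \<le> q"
    using two_le_card_field[where 'a = 'a] q by simp
  obtain a c where ac: "a \<in> nonzero_vecs n" "X = proportional n `` {a}"
    "c \<in> nonzero_vecs n" "Y = proportional n `` {c}"
    using assms(3,4) by (auto simp: proj_space_eq_image)
  have "(q - 1) * card (common_neighbours (proj_space n) (proj_orthogonal n) X Y) =
      q ^ (if X = Y then n - 1 else n - 2) - 1"
    using card_common_neighbours_proj_orthogonal[OF ac(1,3)]
    by (simp add: ac proportional_Image_eq_iff q)
  then have "of_nat (card (common_neighbours (proj_space n) (proj_orthogonal n) X Y)) =
      (of_nat (q ^ (if X = Y then n - 1 else n - 2)) - 1) / (of_nat q - 1 :: 'k)"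
    using \<open>2 \<le> q\<close> by (intro of_nat_eq_divide_if_mult_eq) simp_all
  moreover have "of_nat q ^ (n - 1) = of_nat q * (of_nat q ^ (n - 2) :: 'k)"
    using \<open>2 \<le> n\<close> by (simp add: power_eq_if numeral_2_eq_2)
  moreover have "of_nat q \<noteq> (1 :: 'k)"
    using \<open>2 \<le> q\<close> by (auto simp: of_nat_eq_1_iff)
  ultimately show ?thesis
    by (cases "X = Y") (simp_all add: field_simps)
qed

text \<open>Both sides count the walks of length two from a vertex of \<open>Um0\<close> when \<open>x = q\<close>.\<close>

lemma geometric_sum_square_identity:
  fixes x :: "'k::field"
  assumes "x \<noteq> 1" and "2 \<le> n"
  shows "x ^ (n - 2) + (x ^ (n - 2) - 1) / (x - 1) * ((x ^ n - 1) / (x - 1)) =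
    ((x ^ (n - 1) - 1) / (x - 1))\<^sup>2"
proof -
  obtain m where m: "n = m + 2"
    using \<open>2 \<le> n\<close> that[of "n - 2"] by simp
  define y where "y = x ^ m"
  have "y + (y - 1) / (x - 1) * ((x\<^sup>2 * y - 1) / (x - 1)) =
      (y * (x - 1)\<^sup>2 + (y - 1) * (x\<^sup>2 * y - 1)) / (x - 1)\<^sup>2"
    using \<open>x \<noteq> 1\<close> by (simp add: add_divide_distrib power2_eq_square)
  also have "y * (x - 1)\<^sup>2 + (y - 1) * (x\<^sup>2 * y - 1) = (x * y - 1)\<^sup>2"
    by (simp add: power2_eq_square algebra_simps)
  finally show ?thesis
    by (simp add: m y_def power_divide power_add power2_eq_square mult_ac)
qed

lemma kernel_spectrum_common_neighbours_Um0:
  assumes n: "2 \<le> n" and q: "q = CARD('a::{field,finite})"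
  shows "kernel_spectrum (proj_space n :: 'a vec set set)
      (\<lambda>X Y. of_nat (card (common_neighbours (proj_space n) (proj_orthogonal n) X Y))) =
    complex_of_real ` {((real q ^ (n - 1) - 1) / (real q - 1))\<^sup>2, real q ^ (n - 2)}"
    (is "kernel_spectrum ?A ?N = _")
proof -
  let ?\<alpha> = "of_nat q ^ (n - 2) :: complex"
  let ?\<beta> = "(?\<alpha> - 1) / (of_nat q - 1)"
  have "of_nat q \<noteq> (1 :: complex)"
    using two_le_card_field[where 'a = 'a] q by (auto simp: of_nat_eq_1_iff)
  obtain a b :: "'a vec" where ab:
    "a \<in> nonzero_vecs n" "b \<in> nonzero_vecs n" "(a, b) \<notin> proportional n"
    using ex_not_proportional[OF n] .
  have "kernel_spectrum ?A ?N = kernel_spectrum ?A (\<lambda>X Y. ?\<alpha> * of_bool (X = Y) + ?\<beta>)"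
    by (intro kernel_spectrum_cong of_nat_card_common_neighbours_proj_orthogonal n q)
  also have "\<dots> = {?\<alpha> + ?\<beta> * of_nat (card ?A), ?\<alpha>}"
    by (rule kernel_spectrum_diagonal_plus_const[OF finite_proj_space,
          where a = "proportional n `` {a}" and b = "proportional n `` {b}"])
      (use ab in \<open>auto simp: proj_space_eq_image proportional_Image_eq_iff\<close>)
  also have "?\<alpha> + ?\<beta> * of_nat (card ?A) = ((of_nat q ^ (n - 1) - 1) / (of_nat q - 1))\<^sup>2"
    unfolding of_nat_card_proj_space[OF q]
    by (rule geometric_sum_square_identity[OF \<open>of_nat q \<noteq> 1\<close> n])
  finally show ?thesis
    by simp
qed

theorem adjacency_eigenvalues_Um0:
  assumes n: "2 \<le> n" and q: "q = CARD('a::{field,finite})"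
  shows "adjacency_eigenvalues (Um0 n :: ('a vec set + 'a vec set) pair_pre_digraph) =
    complex_of_real ` {(real q ^ (n - 1) - 1) / (real q - 1),
      - ((real q ^ (n - 1) - 1) / (real q - 1)),
      real q powr (real n / 2 - 1), - (real q powr (real n / 2 - 1))}"
proof -
  let ?d = "(real q ^ (n - 1) - 1) / (real q - 1)"
  have "2 \<le> q"
    using two_le_card_field[where 'a = 'a] q by simp
  then have "0 \<le> ?d"
    by simp
  have "adjacency_eigenvalues (Um0 n :: ('a vec set + 'a vec set) pair_pre_digraph) =
      {k. k\<^sup>2 \<in> complex_of_real ` {?d\<^sup>2, real q ^ (n - 2)}}"
    by (simp only: Um0_eq_bipartite_graph kernel_spectrum_common_neighbours_Um0[OF n q]
        adjacency_eigenvalues_bipartite_graph[OF finite_proj_space sym_on_proj_orthogonal])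
  also have "\<dots> = complex_of_real ` (\<Union>x\<in>{?d\<^sup>2, real q ^ (n - 2)}. {sqrt x, - sqrt x})"
    by (rule Collect_power2_in_of_real_image) auto
  also have "(\<Union>x\<in>{?d\<^sup>2, real q ^ (n - 2)}. {sqrt x, - sqrt x}) =
      {?d, - ?d, real q powr (real n / 2 - 1), - (real q powr (real n / 2 - 1))}"
    using n \<open>0 \<le> ?d\<close> \<open>2 \<le> q\<close>
    by (simp add: sqrt_power_eq_powr diff_divide_distrib insert_commute)
  finally show ?thesis .
qed

theorem theorem1p4:
  fixes n q :: nat
  assumes "q = CARD('a::{field,finite})" and "odd q"
  shows "(n \<ge> 2 \<longrightarrow>
      adjacency_eigenvalues (Um n :: ('a vec + 'a vec) pair_pre_digraph) =
        complex_of_real ` {real q ^ (n - 1), - (real q ^ (n - 1)),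
          real q powr ((real n - 1) / 2), - (real q powr ((real n - 1) / 2)),
          real q powr (real n / 2 - 1), - (real q powr (real n / 2 - 1))}) \<and>
    (n \<ge> 3 \<longrightarrow>
      adjacency_eigenvalues (Um0 n :: ('a vec set + 'a vec set) pair_pre_digraph) =
        complex_of_real ` {(real q ^ (n - 1) - 1) / (real q - 1),
          - ((real q ^ (n - 1) - 1) / (real q - 1)),
          real q powr (real n / 2 - 1), - (real q powr (real n / 2 - 1))})"
proof -
  have "q \<noteq> 2"
    using \<open>odd q\<close> by auto
  then show ?thesis
    by (intro conjI impI adjacency_eigenvalues_Um adjacency_eigenvalues_Um0 assms(1)) simp_all
qed

end
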